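(* Let $\Lambda<0$ and let $A$ be a collision kernel satisfying the assumptions (K1)–(K5) of the context. Then the coupled Einstein–Boltzmann system with cosmological constant $\Lambda$ on the flat Robertson–Walker space-time has no global regular solution; that is, there is no pair $(a,f)$ solving the system on $[0,+\infty[$.
   Context: **Function space.** $L^1_2(\mathbb{R}^3)=\{f\in L^1(\mathbb{R}^3):\ \|f\|:=\int_{\mathbb{R}^3}\sqrt{1+|\bar p|^2}\,|f(\bar p)|\,d\bar p<+\infty\}$, a Banach space. **Collision operator.** For $a>0$ and $\bar p,\bar q\in\mathbb{R}^3$ put $p^0=\sqrt{1+a^2|\bar p|^2}$, $q^0=\sqrt{1+a^2|\bar q|^2}$, $\epsilon=p^0+q^0$. For $\omega\in S^2$ (unit sphere of $\mathbb{R}^3$, area element $d\omega$) put $\bar p'=\bar p+b\,\omega$, $\bar q'=\bar q-b\,\omega$ with $$b=b(\bar p,\bar q,\omega)=\frac{2p^0q^0\,\epsilon\;\omega\cdot\left(\frac{\bar q}{q^0}-\frac{\bar p}{p^0}\right)}{\epsilon^2-a^2(\omega\cdot(\bar p+\bar q))^2},$$ so that $p'^0+q'^0=p^0+q^0$, where $p'^0=\sqrt{1+a^2|\bar p'|^2}$, $q'^0=\sqrt{1+a^2|\bar q'|^2}$. For functions $f,g$ on $\mathbb{R}^3$, $Q(f,g)=Q^+(f,g)-Q^-(f,g)$ with $$Q^+(f,g)(\bar p)=\int_{\mathbb{R}^3}\frac{a^3\,d\bar q}{q^0}\int_{S^2}f(\bar p')g(\bar q')A(a,\bar p,\bar q,\bar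 p',\bar q')\,d\omega,\qquad Q^-(f,g)(\bar p)=\int_{\mathbb{R}^3}\frac{a^3\,d\bar q}{q^0}\int_{S^2}f(\bar p)g(\bar q)A(a,\bar p,\bar q,\bar p',\bar q')\,d\omega.$$ At time $t$ the operator is taken with $a=a(t)$. **Kernel assumptions.** $A$ is a non-negative real-valued regular (at least continuous) function of all its arguments, and for constants $C_1,\gamma>0$: (K1) $0\le A\le C_1$; (K2) $A(a,\bar p,\bar q,\bar p',\bar q')=A(a,\bar q,\bar p,\bar q',\bar p')$; (K3) $A(a,\bar p,\bar q,\bar p',\bar q')=A(a,\bar p',\bar q',\bar p,\bar q)$; (K4) $|A(a_1,\bar p,\bar q,\bar p',\bar q')-A(a_2,\bar p,\bar q,\bar p',\bar q')|\le\gamma|a_1-a_2|$; (K5) $A(a,M\bar p,M\bar q,M\bar p',M\bar q')=A(a,\bar p,\bar q,\bar p',\bar q')$ for all $M\in SO(3)$. **The system.** The metric is $g=-dt^2+a^2(t)[(dx^1)^2+(dx^2)^2+(dx^3)^2]$. A (global, regular) solution is a pair $(a,f)$ with $a:[0,+\infty[\to\,]0,+\infty[$ of class $C^2$ and $f=f(t,\bar p)\ge0$ with $t\mapsto f(t)$ continuous from $[0,+\infty[$ to $L^1_2(\mathbb{R}^3)$ and $f(0)$ invariant under $SO(3)$, satisfying for all $t\ge 0$: (Boltzmann) $\displaystyle \frac{\partial f}{\partial t}-2\frac{\dot a}{a}\sum_{i=1}^3p^i\frac{\partial f}{\partial p^i}=\frac1{p^0}Q(f,f)$, $p^0=\sqrt{1+a^2|\bar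 p|^2}$, understood by characteristics: along $\bar p(t,y)=\frac{a(0)^2}{a(t)^2}y$, for a.e. $y\in\mathbb{R}^3$, $f(t,\bar p(t,y))=f(0,y)+\int_0^t\left[\frac{1}{p^0}Q(f,f)\right](s,\bar p(s,y))\,ds$; (Einstein) $\displaystyle\left(\frac{\dot a}{a}\right)^2=\frac{8\pi}{3}T^{00}+\frac\Lambda3,\qquad \frac{\ddot a}{a}=-\frac{4\pi}{3}(T^{00}+3a^2T^{11})+\frac\Lambda3,$ with $T^{00}=a^3\int_{\mathbb{R}^3}p^0f(t,\bar p)\,d\bar p$ and $T^{11}=a^3\int_{\mathbb{R}^3}\frac{(p^1)^2}{p^0}f(t,\bar p)\,d\bar p$. *)

theory Defs
  imports "HOL-Analysis.Analysis"
begin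

section \<open>The function space\<close>

definition norm_L12 :: "(real^3 \<Rightarrow> real) \<Rightarrow> real" where
  "norm_L12 f = (LINT p|lebesgue. sqrt (1 + (norm p)\<^sup>2) * \<bar>f p\<bar>)"

text \<open>Elements are represented by functions. Below, every condition on the value of a function
  in this space at a single time is therefore imposed almost everywhere.\<close>

definition L12 :: "(real^3 \<Rightarrow> real) set" where
  "L12 = {f. integrable lebesgue f \<and>
             integrable lebesgue (\<lambda>p. sqrt (1 + (norm p)\<^sup>2) * \<bar>f p\<bar>)}"


section \<open>Collisions\<close>

definition energy :: "real \<Rightarrow> real^3 \<Rightarrow> real" where
  "energy a p = sqrt (1 + a\<^sup>2 * (norm p)\<^sup>2)"

definition transfer :: "real \<Rightarrow> real^3 \<Rightarrow> real^3 \<Rightarrow> real^3 \<Rightarrow> real" where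
  "transfer a p q \<omega> =
     (let e = energy a p + energy a q in
      2 * energy a p * energy a q * e * (\<omega> \<bullet> (q /\<^sub>R energy a q - p /\<^sub>R energy a p)) /
      (e\<^sup>2 - a\<^sup>2 * (\<omega> \<bullet> (p + q))\<^sup>2))"

definition post_p :: "real \<Rightarrow> real^3 \<Rightarrow> real^3 \<Rightarrow> real^3 \<Rightarrow> real^3" where
  "post_p a p q \<omega> = p + transfer a p q \<omega> *\<^sub>R \<omega>"

definition post_q :: "real \<Rightarrow> real^3 \<Rightarrow> real^3 \<Rightarrow> real^3 \<Rightarrow> real^3" where
  "post_q a p q \<omega> = q - transfer a p q \<omega> *\<^sub>R \<omega>"

text \<open>The integral over the unit sphere in spherical coordinates, where the area element
  is \<open>sin \<theta> d\<theta> d\<phi>\<close>.\<close>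

definition sphere_point :: "real \<Rightarrow> real \<Rightarrow> real^3" where
  "sphere_point \<theta> \<phi> = vector [sin \<theta> * cos \<phi>, sin \<theta> * sin \<phi>, cos \<theta>]"

definition sphere_integral :: "(real^3 \<Rightarrow> real) \<Rightarrow> real" where
  "sphere_integral F =
     (LINT z:{0..pi} \<times> {0..2 * pi}|lebesgue. sin (fst z) * F (sphere_point (fst z) (snd z)))"

type_synonym kernel = "real \<Rightarrow> real^3 \<Rightarrow> real^3 \<Rightarrow> real^3 \<Rightarrow> real^3 \<Rightarrow> real"

definition Q_gain ::
  "kernel \<Rightarrow> real \<Rightarrow> (real^3 \<Rightarrow> real) \<Rightarrow> (real^3 \<Rightarrow> real) \<Rightarrow> real^3 \<Rightarrow> real" where
  "Q_gain A a f g p =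
     (LINT q|lebesgue. a^3 / energy a q *
        sphere_integral (\<lambda>\<omega>. f (post_p a p q \<omega>) * g (post_q a p q \<omega>) *
                              A a p q (post_p a p q \<omega>) (post_q a p q \<omega>)))"

definition Q_loss ::
  "kernel \<Rightarrow> real \<Rightarrow> (real^3 \<Rightarrow> real) \<Rightarrow> (real^3 \<Rightarrow> real) \<Rightarrow> real^3 \<Rightarrow> real" where
  "Q_loss A a f g p =
     (LINT q|lebesgue. a^3 / energy a q *
        sphere_integral (\<lambda>\<omega>. f p * g q *
                              A a p q (post_p a p q \<omega>) (post_q a p q \<omega>)))"

definition collision_op ::
  "kernel \<Rightarrow> real \<Rightarrow> (real^3 \<Rightarrow> real) \<Rightarrow> (real^3 \<Rightarrow> real) \<Rightarrow> real^3 \<Rightarrow> real" where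
  "collision_op A a f g p = Q_gain A a f g p - Q_loss A a f g p"

text \<open>The scale-factor argument of a kernel is meaningful only for positive values.\<close>

definition collision_kernel :: "real \<Rightarrow> real \<Rightarrow> kernel \<Rightarrow> bool" where
  "collision_kernel C\<^sub>1 \<gamma> A \<longleftrightarrow>
     C\<^sub>1 > 0 \<and> \<gamma> > 0 \<and>
     continuous_on ({0<..} \<times> UNIV) (\<lambda>(a, p, q, p', q'). A a p q p' q') \<and>
     (\<forall>a>0. \<forall>p q p' q'. 0 \<le> A a p q p' q' \<and> A a p q p' q' \<le> C\<^sub>1) \<and>
     (\<forall>a>0. \<forall>p q p' q'. A a p q p' q' = A a q p q' p') \<and>
     (\<forall>a>0. \<forall>p q p' q'. A a p q p' q' = A a p' q' p q) \<and>
     (\<forall>a\<^sub>1>0. \<forall>a\<^sub>2>0. \<forall>p q p' q'.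
        \<bar>A a\<^sub>1 p q p' q' - A a\<^sub>2 p q p' q'\<bar> \<le> \<gamma> * \<bar>a\<^sub>1 - a\<^sub>2\<bar>) \<and>
     (\<forall>a>0. \<forall>M. rotation_matrix M \<longrightarrow>
        (\<forall>p q p' q'. A a (M *v p) (M *v q) (M *v p') (M *v q') = A a p q p' q'))"


section \<open>The coupled system\<close>

definition T00 :: "real \<Rightarrow> (real^3 \<Rightarrow> real) \<Rightarrow> real" where
  "T00 a f = a^3 * (LINT p|lebesgue. energy a p * f p)"

definition T11 :: "real \<Rightarrow> (real^3 \<Rightarrow> real) \<Rightarrow> real" where
  "T11 a f = a^3 * (LINT p|lebesgue. (p $ 1)\<^sup>2 / energy a p * f p)"

definition characteristic :: "(real \<Rightarrow> real) \<Rightarrow> real \<Rightarrow> real^3 \<Rightarrow> real^3" where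
  "characteristic a t y = ((a 0)\<^sup>2 / (a t)\<^sup>2) *\<^sub>R y"

definition boltzmann :: "kernel \<Rightarrow> (real \<Rightarrow> real) \<Rightarrow> (real \<Rightarrow> real^3 \<Rightarrow> real) \<Rightarrow> bool" where
  "boltzmann A a f \<longleftrightarrow>
     (\<forall>t\<ge>0. AE y in lebesgue.
        let R = (\<lambda>s. collision_op A (a s) (f s) (f s) (characteristic a s y) /
                     energy (a s) (characteristic a s y))
        in set_integrable lebesgue {0..t} R \<and>
           f t (characteristic a t y) = f 0 y + (LINT s:{0..t}|lebesgue. R s))"

text \<open>The functions \<open>a'\<close> and \<open>a''\<close> are the first two derivatives of the scale factor,
  one-sided at time 0.\<close>

definition einstein ::
  "real \<Rightarrow> (real \<Rightarrow> real) \<Rightarrow> (real \<Rightarrow> real) \<Rightarrow> (real \<Rightarrow> real) \<Rightarrow> (real \<Rightarrow> real^3 \<Rightarrow> real) \<Rightarrow> bool" where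
  "einstein \<Lambda> a a' a'' f \<longleftrightarrow>
     (\<forall>t\<ge>0. (a' t / a t)\<^sup>2 = 8 * pi / 3 * T00 (a t) (f t) + \<Lambda> / 3 \<and>
            a'' t / a t =
              - (4 * pi / 3) * (T00 (a t) (f t) + 3 * (a t)\<^sup>2 * T11 (a t) (f t)) + \<Lambda> / 3)"

definition global_regular_solution ::
  "real \<Rightarrow> kernel \<Rightarrow> (real \<Rightarrow> real) \<Rightarrow> (real \<Rightarrow> real^3 \<Rightarrow> real) \<Rightarrow> bool" where
  "global_regular_solution \<Lambda> A a f \<longleftrightarrow>
     (\<forall>t\<ge>0. a t > 0) \<and>
     (\<forall>t\<ge>0. f t \<in> L12 \<and> (AE p in lebesgue. f t p \<ge> 0)) \<and>
     (\<forall>t\<ge>0. ((\<lambda>s. norm_L12 (\<lambda>p. f s p - f t p)) \<longlongrightarrow> 0) (at t within {0..})) \<and>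
     (\<forall>M. rotation_matrix M \<longrightarrow> (AE p in lebesgue. f 0 (M *v p) = f 0 p)) \<and>
     boltzmann A a f \<and>
     (\<exists>a' a''.
        (\<forall>t\<ge>0. (a has_real_derivative a' t) (at t within {0..})) \<and>
        (\<forall>t\<ge>0. (a' has_real_derivative a'' t) (at t within {0..})) \<and>
        continuous_on {0..} a'' \<and>
        einstein \<Lambda> a a' a'' f)"

end

(* Since (a'/a)^2 is non-negative, the first Einstein equation forces T00 >= -\<Lambda>/(8 pi), and
   T11 >= 0 because f >= 0; the second equation then gives a'' <= (\<Lambda>/2) a < 0. No positive
   function on the half-line satisfies this: if a' is negative somewhere, concavity drives a to
   negative values in finite time; otherwise a >= a(0), so a'' <= (\<Lambda>/2) a(0) makes a' negative
   after all. *)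

theory Submission
  imports Defs
begin

text \<open>The mean value theorem on \<open>{s..t}\<close>, where the derivative within
  \<open>{0..}\<close> restricts. Working within \<open>{0..}\<close> allows \<open>s = 0\<close>,
  where only a one-sided derivative is available.\<close>

lemma has_real_derivative_bounded_imp_le:
  fixes g g' :: "real \<Rightarrow> real"
  assumes deriv: "\<And>x. x \<ge> 0 \<Longrightarrow> (g has_real_derivative g' x) (at x within {0..})"
    and bound: "\<And>x. s \<le> x \<Longrightarrow> x \<le> t \<Longrightarrow> g' x \<le> c"
    and "0 \<le> s" "s \<le> t"
  shows "g t \<le> g s + c * (t - s)"
proof (cases "s = t")
  case False
  with \<open>s \<le> t\<close> have "s < t" by simp
  have "(g has_derivative (*) (g' x)) (at x within {s..t})" if "s \<le> x" "x \<le> t" for x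
    using has_field_derivative_subset[OF deriv, of x "{s..t}"] that \<open>0 \<le> s\<close>
    by (auto simp: has_field_derivative_def)
  from mvt_simple[OF \<open>s < t\<close> this]
  obtain x where x: "s < x" "x < t" "g t - g s = g' x * (t - s)"
    by auto
  have "g' x * (t - s) \<le> c * (t - s)"
    using bound[of x] x \<open>s < t\<close> by (intro mult_right_mono) auto
  with x(3) show ?thesis by simp
qed simp

lemma not_positive_of_second_derivative_le:
  fixes a a' a'' :: "real \<Rightarrow> real"
  assumes pos: "\<And>t. t \<ge> 0 \<Longrightarrow> a t > 0"
    and d1: "\<And>t. t \<ge> 0 \<Longrightarrow> (a has_real_derivative a' t) (at t within {0..})"
    and d2: "\<And>t. t \<ge> 0 \<Longrightarrow> (a' has_real_derivative a'' t) (at t within {0..})"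
    and le: "\<And>t. t \<ge> 0 \<Longrightarrow> a'' t \<le> - k * a t"
    and "k > 0"
  shows False
proof -
  have nonneg: "a' s \<ge> 0" if "s \<ge> 0" for s
  proof (rule ccontr)
    assume "\<not> a' s \<ge> 0"
    hence neg: "a' s < 0" by simp
    \<comment> \<open>The zero of the tangent line to \<open>a\<close> at \<open>s\<close>. By
      concavity \<open>a\<close> lies below this line after \<open>s\<close>, so \<open>a t\<close>
      cannot be positive.\<close>
    define t where "t = s + a s / - a' s"
    have "t \<ge> s" using divide_pos_neg[OF pos[OF that] neg] by (simp add: t_def)
    have "a' x \<le> a' s" if "s \<le> x" for x
    proof -
      have "a'' y \<le> 0" if "s \<le> y" for y
        using le[of y] pos[of y] mult_pos_pos[OF \<open>k > 0\<close> pos[of y]] that \<open>s \<ge> 0\<close> by simp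
      from has_real_derivative_bounded_imp_le[OF d2 this \<open>s \<ge> 0\<close> that] show ?thesis by simp
    qed
    from has_real_derivative_bounded_imp_le[OF d1 this \<open>s \<ge> 0\<close> \<open>t \<ge> s\<close>]
    have "a t \<le> a s + a' s * (t - s)" .
    also have "\<dots> = 0" using neg by (simp add: t_def)
    finally show False using pos[of t] \<open>t \<ge> s\<close> that by simp
  qed
  have mono: "a 0 \<le> a x" if "x \<ge> 0" for x
  proof -
    \<comment> \<open>A lower bound on \<open>a\<close> is an upper bound on its negative, whose
      derivative is at most 0.\<close>
    have "((\<lambda>t. - a t) has_real_derivative - a' t) (at t within {0..})" if "t \<ge> 0" for t
      by (rule DERIV_minus[OF d1[OF that]])
    from has_real_derivative_bounded_imp_le[OF this, of 0 x 0] nonneg that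
    show ?thesis by simp
  qed
  \<comment> \<open>Chosen so that \<open>a' 0 - k * a 0 * t\<close>, the upper bound for
    \<open>a' t\<close>, equals -1.\<close>
  define t where "t = (a' 0 + 1) / (k * a 0)"
  have ka: "k * a 0 > 0" using pos[of 0] \<open>k > 0\<close> by simp
  have "t \<ge> 0" using nonneg[of 0] ka by (simp add: t_def)
  have "a'' x \<le> - (k * a 0)" if "0 \<le> x" for x
    using le[OF that] mult_left_mono[OF mono[OF that] less_imp_le[OF \<open>k > 0\<close>]] by linarith
  from has_real_derivative_bounded_imp_le[OF d2 this, of 0 t] \<open>t \<ge> 0\<close>
  have "a' t \<le> a' 0 - k * a 0 * t" by simp
  also have "\<dots> = -1" unfolding t_def using ka by (subst times_divide_eq_right, subst nonzero_mult_div_cancel_left) auto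
  finally show False using nonneg[OF \<open>t \<ge> 0\<close>] by simp
qed

lemma T11_nonneg:
  assumes "a > 0" "AE p in lebesgue. f p \<ge> 0"
  shows "T11 a f \<ge> 0"
proof -
  have "AE p in lebesgue. 0 \<le> (p $ 1)\<^sup>2 / energy a p * f p"
    using assms(2) by eventually_elim (simp add: energy_def)
  thus ?thesis
    using \<open>a > 0\<close> by (auto simp: T11_def intro!: mult_nonneg_nonneg integral_nonneg_AE)
qed

text \<open>Eliminating \<open>T00\<close> between the two equations gives
  \<open>a''/a = - (a'/a)^2 / 2 - 4 * pi * a^2 * T11 + \<Lambda> / 2\<close>, and the first two
  terms are at most 0.\<close>

lemma einstein_second_derivative_le:
  assumes ein: "einstein \<Lambda> a a' a'' f" and "t \<ge> 0" "a t > 0" "AE p in lebesgue. f t p \<ge> 0"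
  shows "a'' t \<le> \<Lambda> / 2 * a t"
proof -
  let ?T0 = "T00 (a t) (f t)" and ?T1 = "(a t)\<^sup>2 * T11 (a t) (f t)"
  \<comment> \<open>The products of \<open>pi\<close> with \<open>?T0\<close> and \<open>?T1\<close>
    are kept together as atoms, so that the remaining inequality is linear.\<close>
  have eq1: "(a' t / a t)\<^sup>2 = 8 * (pi * ?T0) / 3 + \<Lambda> / 3"
    and eq2: "a'' t / a t = - (4 * (pi * ?T0) / 3) - 4 * (pi * ?T1) + \<Lambda> / 3"
    using ein \<open>t \<ge> 0\<close> unfolding einstein_def by (simp_all add: distrib_left)
  have "pi * ?T1 \<ge> 0"
    using T11_nonneg[OF assms(3,4)] by simp
  moreover have "8 * (pi * ?T0) / 3 + \<Lambda> / 3 \<ge> 0"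
    unfolding eq1[symmetric] by simp
  ultimately have "a'' t / a t \<le> \<Lambda> / 2"
    using eq2 by linarith
  thus ?thesis using \<open>a t > 0\<close> by (simp add: pos_divide_le_eq)
qed

theorem proposition4p2:
  fixes \<Lambda> C\<^sub>1 \<gamma> :: real and A :: kernel
  assumes "\<Lambda> < 0"
    and "collision_kernel C\<^sub>1 \<gamma> A"
  shows "\<not> (\<exists>a f. global_regular_solution \<Lambda> A a f)"
proof
  assume "\<exists>a f. global_regular_solution \<Lambda> A a f"
  then obtain a f where sol: "global_regular_solution \<Lambda> A a f" by blast
  hence pos: "\<And>t. t \<ge> 0 \<Longrightarrow> a t > 0"
    and f: "\<And>t. t \<ge> 0 \<Longrightarrow> AE p in lebesgue. f t p \<ge> 0"
    unfolding global_regular_solution_def by simp_all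
  from sol have "\<exists>a' a''.
      (\<forall>t\<ge>0. (a has_real_derivative a' t) (at t within {0..})) \<and>
      (\<forall>t\<ge>0. (a' has_real_derivative a'' t) (at t within {0..})) \<and>
      continuous_on {0..} a'' \<and> einstein \<Lambda> a a' a'' f"
    unfolding global_regular_solution_def by (elim conjE)
  then obtain a' a'' where
    d1: "\<And>t. t \<ge> 0 \<Longrightarrow> (a has_real_derivative a' t) (at t within {0..})" and
    d2: "\<And>t. t \<ge> 0 \<Longrightarrow> (a' has_real_derivative a'' t) (at t within {0..})" and
    ein: "einstein \<Lambda> a a' a'' f"
    by blast
  \<comment> \<open>The rate \<open>k = - \<Lambda> / 2\<close> is positive exactly because
    \<open>\<Lambda>\<close> is negative.\<close>
  have "a'' t \<le> - (- \<Lambda> / 2) * a t" if "t \<ge> 0" for t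
    using einstein_second_derivative_le[OF ein that pos[OF that] f[OF that]] by simp
  from not_positive_of_second_derivative_le[OF pos d1 d2 this] \<open>\<Lambda> < 0\<close> show False by simp
qed

end
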